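(* For every positive integer $n$, the sequence of over-Mahonian numbers $\{i_{B'}(n,k)\}_{0\le k\le\binom n2}$ is unimodal in $k$.
   Context: For $n\ge 1$, $B'_n$ denotes the set of overlined permutations of $\{1,\dots,n\}$ of the following kind: an element is a permutation $\sigma=\sigma_1\sigma_2\cdots\sigma_n$ of $\{1,\dots,n\}$ (in one-line notation) in which each entry $\sigma_i$ is independently either overlined or not overlined, subject to the condition that $\sigma_i$ may be overlined only if there is an index $j>i$ with $\sigma_i>\sigma_j$ (overlines are ignored in comparing entries). An inversion of such an element is a pair of positions $i<j$ with $\sigma_i>\sigma_j$, again ignoring overlines. The over-Mahonian number $i_{B'}(n,k)$ is the number of elements of $B'_n$ with exactly $k$ inversions. A finite sequence of real numbers $a_0,\dots,a_m$ is unimodal if there is an index $0\le m^*\le m$ with $a_0\le a_1\le\cdots\le a_{m^*}$ and $a_{m^*}\ge a_{m^*+1}\ge\cdots\ge a_m$. *)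

theory Defs
  imports Complex_Main "HOL-Combinatorics.Permutations"
begin

text \<open>
  The one-line notation \<open>\<sigma>\<^sub>1 \<dots> \<sigma>\<^sub>n\<close> is read as the function \<open>i \<mapsto> \<sigma> i\<close>, which
  \<^const>\<open>permutes\<close> forces to be the identity outside \<open>{1..n}\<close>.
  An overlined permutation is a pair \<open>(\<sigma>, S)\<close>, where \<open>S\<close> is the set of the \<^emph>\<open>positions\<close>
  \<open>i\<close> (not of the values) whose entry \<open>\<sigma> i\<close> is overlined.
\<close>

definition overlined_perms :: "nat \<Rightarrow> ((nat \<Rightarrow> nat) \<times> nat set) set" where
  "overlined_perms n =
     {(\<sigma>, S). \<sigma> permutes {1..n} \<and> S \<subseteq> {1..n} \<and>
              (\<forall>i\<in>S. \<exists>j\<in>{1..n}. i < j \<and> \<sigma> i > \<sigma> j)}"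

definition inversions :: "nat \<Rightarrow> (nat \<Rightarrow> nat) \<Rightarrow> (nat \<times> nat) set" where
  "inversions n \<sigma> = {(i, j). i \<in> {1..n} \<and> j \<in> {1..n} \<and> i < j \<and> \<sigma> i > \<sigma> j}"

definition over_Mahonian :: "nat \<Rightarrow> nat \<Rightarrow> nat" where
  "over_Mahonian n k = card {(\<sigma>, S) \<in> overlined_perms n. card (inversions n \<sigma>) = k}"

text \<open>The finite sequence \<open>a 0, \<dots>, a m\<close>; values of \<open>a\<close> beyond \<open>m\<close> play no role.\<close>

definition unimodal_upto :: "(nat \<Rightarrow> real) \<Rightarrow> nat \<Rightarrow> bool" where
  "unimodal_upto a m \<longleftrightarrow>
     (\<exists>p\<le>m. (\<forall>k<p. a k \<le> a (Suc k)) \<and> (\<forall>k. p \<le> k \<and> k < m \<longrightarrow> a k \<ge> a (Suc k)))"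

end

theory Submission
  imports Defs
begin

text \<open>
  Removing the largest entry \<open>n + 1\<close> from a permutation of \<open>{1..n+1}\<close> changes neither the
  inversions between the other entries nor which of them may be overlined: the largest entry is
  never the smaller member of an inversion. If \<open>c\<close> entries stand to its right, it takes part in
  exactly \<open>c\<close> inversions, and it may be overlined precisely when \<open>c > 0\<close>. So the generating
  function of the over-Mahonian numbers gains, in passing from \<open>n\<close> to \<open>n + 1\<close>, the factor
  \<open>1 + 2q + 2q\<^sup>2 + \<dots> + 2q\<^sup>n\<close> (lemma \<open>over_Mahonian_Suc\<close>).

  Multiplication by such a factor preserves unimodality. For a sequence \<open>a\<close> with a peak at \<open>p\<close>,
  the new sequence has differences \<open>d k = a (k+1) + a k - 2 a (k-n)\<close>. They are
  nonnegative while all three arguments lie left of \<open>p\<close>, nonpositive once all lie right of \<open>p\<close>,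
  and in between they decrease weakly, since there the first two arguments have passed the peak
  while the third still climbs towards it. Hence \<open>d\<close> changes sign at most once
  (lemma \<open>has_peak_window_sum\<close>), and unimodality follows by induction on \<open>n\<close>.
\<close>

section \<open>Unimodality of weighted window sums\<close>

text \<open>
  Indexing by all integers lets a finite sequence be padded with zeros on both sides, so that
  shifted terms need no boundary cases.
\<close>

definition has_peak :: "(int \<Rightarrow> real) \<Rightarrow> int \<Rightarrow> bool" where
  "has_peak a p \<longleftrightarrow>
     (\<forall>i j. i \<le> j \<and> j \<le> p \<longrightarrow> a i \<le> a j) \<and> (\<forall>i j. p \<le> i \<and> i \<le> j \<longrightarrow> a j \<le> a i)"

lemma has_peakI_step:
  assumes up: "\<And>k. k < p \<Longrightarrow> a k \<le> a (k + 1)"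
    and down: "\<And>k. p \<le> k \<Longrightarrow> a (k + 1) \<le> a k"
  shows "has_peak a p"
proof -
  have "a i \<le> a j" if "i \<le> j" "j \<le> p" for i j
    using that
  proof (induction j rule: int_ge_induct)
    case (step j)
    then show ?case using up[of j] by auto
  qed simp
  moreover have "a j \<le> a i" if "i \<le> j" "p \<le> i" for i j
    using that
  proof (induction j rule: int_ge_induct)
    case (step j)
    then show ?case using down[of j] by auto
  qed simp
  ultimately show ?thesis unfolding has_peak_def by blast
qed

lemma window_sum_diff:
  fixes a :: "int \<Rightarrow> real"
  shows "(\<Sum>i=1..n. a (k + 1 - int i)) - (\<Sum>i=1..n. a (k - int i)) = a k - a (k - int n)"
  by (induction n) (simp_all add: algebra_simps)

text \<open>
  The peak of the new sequence is the first place in \<open>{p..p+n}\<close> where its difference is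
  nonpositive; the difference does not increase on that interval and stays nonpositive beyond it,
  so it never becomes positive again.
\<close>

lemma has_peak_window_sum:
  assumes "has_peak a p"
  shows "\<exists>q. has_peak (\<lambda>k. a k + 2 * (\<Sum>i=1..n. a (k - int i))) q"
proof -
  define d where "d k = a (k + 1) + a k - 2 * a (k - int n)" for k
  have up: "a i \<le> a j" if "i \<le> j" "j \<le> p" for i j
    using assms that unfolding has_peak_def by blast
  have down: "a j \<le> a i" if "p \<le> i" "i \<le> j" for i j
    using assms that unfolding has_peak_def by blast
  have left: "d k \<ge> 0" if "k < p" for k
    using up[of "k - int n" k] up[of "k - int n" "k + 1"] that by (simp add: d_def)
  have right: "d k \<le> 0" if "p + int n \<le> k" for k
    using down[of "k - int n" k] down[of "k - int n" "k + 1"] that by (simp add: d_def)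
  have middle: "d l \<le> d k" if "p \<le> k" "k \<le> l" "l \<le> p + int n" for k l
    using down[of k l] down[of "k + 1" "l + 1"] up[of "k - int n" "l - int n"] that
    by (simp add: d_def)
  define m where "m = (LEAST m. d (p + int m) \<le> 0)"
  have "d (p + int n) \<le> 0" by (rule right) simp
  then have m: "d (p + int m) \<le> 0" "m \<le> n"
    unfolding m_def by (auto intro: LeastI Least_le)
  have before: "d k \<ge> 0" if "k < p + int m" for k
  proof (cases "k < p")
    case False
    then have "nat (k - p) < m" "p + int (nat (k - p)) = k" using that by auto
    then show ?thesis using not_less_Least[of "nat (k - p)" "\<lambda>m. d (p + int m) \<le> 0"]
      by (simp add: m_def)
  qed (rule left)
  have after: "d k \<le> 0" if "p + int m \<le> k" for k
    using middle[of "p + int m" k] m that right[of k] by (cases "k \<le> p + int n") auto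
  have "has_peak (\<lambda>k. a k + 2 * (\<Sum>i=1..n. a (k - int i))) (p + int m)"
  proof (rule has_peakI_step)
    fix k assume "k < p + int m"
    then show "a k + 2 * (\<Sum>i=1..n. a (k - int i))
        \<le> a (k + 1) + 2 * (\<Sum>i=1..n. a (k + 1 - int i))"
      using before[of k] window_sum_diff[of a k n] by (simp add: d_def)
  next
    fix k assume "p + int m \<le> k"
    then show "a (k + 1) + 2 * (\<Sum>i=1..n. a (k + 1 - int i))
        \<le> a k + 2 * (\<Sum>i=1..n. a (k - int i))"
      using after[of k] window_sum_diff[of a k n] by (simp add: d_def)
  qed
  then show ?thesis by blast
qed

lemma unimodal_upto_if_has_peak:
  assumes "has_peak a p"
  shows "unimodal_upto (\<lambda>k. a (int k)) m"
  unfolding unimodal_upto_def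
proof (intro exI conjI allI impI)
  \<comment> \<open>The peak may lie outside \<open>{0..m}\<close>; clipping it to that range keeps both monotonicity claims.\<close>
  show "nat (min p (int m)) \<le> m" by simp
  show "a (int k) \<le> a (int (Suc k))" if "k < nat (min p (int m))" for k
    using assms that unfolding has_peak_def by auto
  show "a (int (Suc k)) \<le> a (int k)" if "nat (min p (int m)) \<le> k \<and> k < m" for k
    using assms that unfolding has_peak_def by (auto simp: min_def split: if_splits)
qed

section \<open>Overlined permutations as weighted permutations\<close>

lemma finite_inversions [simp]: "finite (inversions n \<sigma>)"
  by (rule finite_subset[of _ "{1..n} \<times> {1..n}"]) (auto simp: inversions_def)

text \<open>
  The positions that may carry an overline are the left ends of inversions, and every subset of them
  is allowed. Putting the condition on the number of inversions into the summand leaves a sum over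
  all permutations, which can be reindexed by a bijection.
\<close>

lemma over_Mahonian_weighted:
  "over_Mahonian n k =
     (\<Sum>\<sigma> | \<sigma> permutes {1..n}. if card (inversions n \<sigma>) = k
        then 2 ^ card (fst ` inversions n \<sigma>) else 0)"
proof -
  let ?P = "{\<sigma>. \<sigma> permutes {1..n} \<and> card (inversions n \<sigma>) = k}"
  have fin: "finite {\<sigma>. \<sigma> permutes {1..n}}" by (simp add: finite_permutations)
  have domain: "fst ` inversions n \<sigma> = {i\<in>{1..n}. \<exists>j\<in>{1..n}. i < j \<and> \<sigma> i > \<sigma> j}" for \<sigma>
    unfolding inversions_def Domain_fst[symmetric] by (auto simp: Domain_iff simp del: atLeastAtMost_iff)
  have "{(\<sigma>, S) \<in> overlined_perms n. card (inversions n \<sigma>) = k}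
      = Sigma ?P (\<lambda>\<sigma>. Pow (fst ` inversions n \<sigma>))"
  proof (rule set_eqI, clarify)
    fix \<sigma> S
    have "S \<subseteq> fst ` inversions n \<sigma> \<longleftrightarrow>
        S \<subseteq> {1..n} \<and> (\<forall>i\<in>S. \<exists>j\<in>{1..n}. i < j \<and> \<sigma> i > \<sigma> j)"
      unfolding domain by blast
    then show "(\<sigma>, S) \<in> {(\<sigma>, S) \<in> overlined_perms n. card (inversions n \<sigma>) = k} \<longleftrightarrow>
        (\<sigma>, S) \<in> Sigma ?P (\<lambda>\<sigma>. Pow (fst ` inversions n \<sigma>))"
      unfolding overlined_perms_def mem_Sigma_iff Pow_iff mem_Collect_eq prod.case by blast
  qed
  then have "over_Mahonian n k = (\<Sum>\<sigma>\<in>?P. 2 ^ card (fst ` inversions n \<sigma>))"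
    unfolding over_Mahonian_def using fin by (simp add: card_Pow card_SigmaI)
  also have "\<dots> = (\<Sum>\<sigma> | \<sigma> permutes {1..n}. if card (inversions n \<sigma>) = k
        then 2 ^ card (fst ` inversions n \<sigma>) else 0)"
    using fin by (simp add: sum.inter_filter[symmetric])
  finally show ?thesis .
qed

section \<open>Inserting the largest entry\<close>

text \<open>
  Composing a permutation of \<open>{1..n}\<close> with this cycle on the right inserts the entry \<open>n + 1\<close> at
  position \<open>p\<close> of its one-line notation.
\<close>

definition insertion_cycle :: "nat \<Rightarrow> nat \<Rightarrow> nat \<Rightarrow> nat" where
  "insertion_cycle n p i =
     (if i = p then Suc n else if p < i \<and> i \<le> Suc n then i - 1 else i)"

text \<open>
  The position in the enlarged word of an entry that stood at position \<open>i\<close> before the insertion.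
\<close>

definition skip_position :: "nat \<Rightarrow> nat \<Rightarrow> nat" where
  "skip_position p i = (if i < p then i else Suc i)"

lemma insertion_cycle_at [simp]: "insertion_cycle n p p = Suc n"
  by (simp add: insertion_cycle_def)

lemma insertion_cycle_skip:
  "i \<le> n \<Longrightarrow> insertion_cycle n p (skip_position p i) = i"
  by (auto simp: insertion_cycle_def skip_position_def)

lemma inj_skip_position: "inj (skip_position p)"
  by (auto simp: inj_def skip_position_def split: if_splits)

lemma skip_position_less_iff: "skip_position p i < skip_position p j \<longleftrightarrow> i < j"
  by (auto simp: skip_position_def)

lemma skip_position_neq [simp]: "skip_position p i \<noteq> p" "p \<noteq> skip_position p i"
  by (auto simp: skip_position_def)

lemma positions_Suc_eq:
  assumes "p \<in> {1..Suc n}"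
  shows "{1..Suc n} = insert p (skip_position p ` {1..n})"
proof (rule set_eqI)
  fix i
  show "i \<in> {1..Suc n} \<longleftrightarrow> i \<in> insert p (skip_position p ` {1..n})"
    using assms
    by (cases i p rule: linorder_cases)
       (auto simp: skip_position_def image_iff Bex_def intro!: exI[of _ "i - 1"])
qed

lemma insertion_cycle_permutes:
  assumes "p \<in> {1..Suc n}"
  shows "insertion_cycle n p permutes {1..Suc n}"
proof (rule bij_imp_permutes)
  have "inj_on (insertion_cycle n p) {1..Suc n}"
    using assms by (auto simp: inj_on_def insertion_cycle_def split: if_splits)
  moreover have "insertion_cycle n p ` {1..Suc n} \<subseteq> {1..Suc n}"
    using assms by (auto simp: insertion_cycle_def)
  ultimately show "bij_betw (insertion_cycle n p) {1..Suc n} {1..Suc n}"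
    by (simp add: bij_betw_def endo_inj_surj)
  show "insertion_cycle n p i = i" if "i \<notin> {1..Suc n}" for i
    using assms that by (auto simp: insertion_cycle_def)
qed

lemma permutes_fixes_Suc:
  assumes "\<sigma> permutes {1..n}"
  shows "\<sigma> (Suc n) = Suc n"
  using assms by (rule permutes_not_in) simp

text \<open>
  The insertion is undone by reading off the position \<open>p\<close> of the entry \<open>n + 1\<close> and cancelling the
  cycle for that \<open>p\<close>.
\<close>

lemma bij_betw_insert_largest:
  "bij_betw (\<lambda>(p, \<sigma>). \<sigma> \<circ> insertion_cycle n p)
     ({1..Suc n} \<times> {\<sigma>. \<sigma> permutes {1..n}}) {\<pi>. \<pi> permutes {1..Suc n}}"
proof (rule bij_betwI')
  fix x y
  assume "x \<in> {1..Suc n} \<times> {\<sigma>. \<sigma> permutes {1..n}}" "y \<in> {1..Suc n} \<times> {\<sigma>. \<sigma> permutes {1..n}}"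
  then obtain p \<sigma> r \<tau> where xy: "x = (p, \<sigma>)" "y = (r, \<tau>)" "p \<in> {1..Suc n}" "r \<in> {1..Suc n}"
    "\<sigma> permutes {1..n}" "\<tau> permutes {1..n}" by blast
  have "p = r \<and> \<sigma> = \<tau>" if eq: "\<sigma> \<circ> insertion_cycle n p = \<tau> \<circ> insertion_cycle n r"
  proof -
    have \<tau>': "\<tau> \<circ> insertion_cycle n r permutes {1..Suc n}"
      by (rule permutes_compose[OF insertion_cycle_permutes[OF xy(4)] permutes_subset[OF xy(6)]]) simp
    have "(\<tau> \<circ> insertion_cycle n r) p = (\<tau> \<circ> insertion_cycle n r) r"
      using fun_cong[OF eq, of p] permutes_fixes_Suc[OF xy(5)] permutes_fixes_Suc[OF xy(6)] by simp
    then have "p = r" using permutes_inj[OF \<tau>'] by (simp only: inj_eq)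
    have "\<sigma> i = \<tau> i" for i
    proof -
      obtain j where "i = insertion_cycle n p j"
        using permutes_surj[OF insertion_cycle_permutes[OF xy(3)]] by (rule surjE)
      then show ?thesis using fun_cong[OF eq, of j] \<open>p = r\<close> by simp
    qed
    then show ?thesis using \<open>p = r\<close> by blast
  qed
  then show "((\<lambda>(p, \<sigma>). \<sigma> \<circ> insertion_cycle n p) x = (\<lambda>(p, \<sigma>). \<sigma> \<circ> insertion_cycle n p) y) = (x = y)"
    using xy by auto
next
  fix x assume "x \<in> {1..Suc n} \<times> {\<sigma>. \<sigma> permutes {1..n}}"
  then show "(\<lambda>(p, \<sigma>). \<sigma> \<circ> insertion_cycle n p) x \<in> {\<pi>. \<pi> permutes {1..Suc n}}"
    by (force intro: permutes_compose[OF insertion_cycle_permutes] permutes_subset)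
next
  fix \<pi> assume "\<pi> \<in> {\<pi>. \<pi> permutes {1..Suc n}}"
  then have \<pi>: "\<pi> permutes {1..Suc n}" by simp
  define p where "p = inv \<pi> (Suc n)"
  define \<sigma> where "\<sigma> = \<pi> \<circ> inv (insertion_cycle n p)"
  have p: "p \<in> {1..Suc n}"
    using permutes_in_image[OF permutes_inv[OF \<pi>], of "Suc n"] by (simp add: p_def)
  note c = insertion_cycle_permutes[OF p]
  have inv_c: "inv (insertion_cycle n p) (Suc n) = p"
    using permutes_inverses(2)[OF c, of p] by simp
  have "\<sigma> permutes {1..n}"
  proof (rule permutes_superset)
    show "\<sigma> permutes {1..Suc n}"
      unfolding \<sigma>_def by (intro permutes_compose permutes_inv c \<pi>)
    have "\<sigma> (Suc n) = Suc n"
      using permutes_inverses(1)[OF \<pi>] by (simp add: \<sigma>_def inv_c) (simp add: p_def)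
    then show "\<And>i. i \<in> {1..Suc n} - {1..n} \<Longrightarrow> \<sigma> i = i" by (metis Diff_iff atLeastAtMost_iff le_SucE)
  qed
  moreover have "\<pi> = \<sigma> \<circ> insertion_cycle n p"
    by (simp add: \<sigma>_def comp_assoc permutes_inv_o(2)[OF c])
  ultimately show "\<exists>x\<in>{1..Suc n} \<times> {\<sigma>. \<sigma> permutes {1..n}}.
      \<pi> = (\<lambda>(p, \<sigma>). \<sigma> \<circ> insertion_cycle n p) x"
    using p by auto
qed

text \<open>
  The old entries keep their relative order, and the new one exceeds all of them, so it forms an
  inversion with each entry to its right and with none to its left.
\<close>

lemma inversions_insert_largest:
  assumes p: "p \<in> {1..Suc n}" and \<sigma>: "\<sigma> permutes {1..n}"
  shows "inversions (Suc n) (\<sigma> \<circ> insertion_cycle n p) =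
    map_prod (skip_position p) (skip_position p) ` inversions n \<sigma> \<union> {p} \<times> {p<..Suc n}"
    (is "?L = ?R")
proof -
  let ?s = "skip_position p" and ?\<pi> = "\<sigma> \<circ> insertion_cycle n p"
  have at_p: "?\<pi> p = Suc n" using permutes_fixes_Suc[OF \<sigma>] by simp
  have skip: "?\<pi> (?s i) = \<sigma> i" if "i \<in> {1..n}" for i
    using that by (simp add: insertion_cycle_skip)
  have small: "\<sigma> i < Suc n" if "i \<in> {1..n}" for i
    using permutes_in_image[OF \<sigma>, of i] that by simp
  have mem: "(i, j) \<in> inversions (Suc n) ?\<pi> \<longleftrightarrow>
      i \<in> {1..Suc n} \<and> j \<in> {1..Suc n} \<and> i < j \<and> ?\<pi> i > ?\<pi> j" for i j
    by (simp add: inversions_def)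
  have cases: "i = p \<or> (\<exists>i'\<in>{1..n}. i = ?s i')" if "i \<in> {1..Suc n}" for i
    using that positions_Suc_eq[OF p] by blast
  have ran: "?s i \<in> {1..Suc n}" if "i \<in> {1..n}" for i
    using that positions_Suc_eq[OF p] by blast
  show ?thesis
  proof (rule set_eqI, clarify)
    fix i j
    show "(i, j) \<in> ?L \<longleftrightarrow> (i, j) \<in> ?R"
    proof
      assume "(i, j) \<in> ?L"
      then have ij: "i \<in> {1..Suc n}" "j \<in> {1..Suc n}" "i < j" "?\<pi> i > ?\<pi> j"
        unfolding mem by blast+
      from cases[OF ij(1)] show "(i, j) \<in> ?R"
      proof
        assume "i = p" then show ?thesis using ij by simp
      next
        assume "\<exists>i'\<in>{1..n}. i = ?s i'"
        then obtain i' where i': "i' \<in> {1..n}" "i = ?s i'" by blast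
        then have "?\<pi> j \<noteq> Suc n" using ij(4) skip small by fastforce
        then have "j \<noteq> p" using at_p by blast
        then obtain j' where j': "j' \<in> {1..n}" "j = ?s j'" using cases[OF ij(2)] by blast
        have "(i', j') \<in> inversions n \<sigma>"
          using i' j' ij(3,4) skip[of i'] skip[of j']
          by (simp add: inversions_def skip_position_less_iff)
        then show ?thesis using i'(2) j'(2) by force
      qed
    next
      assume "(i, j) \<in> ?R"
      then show "(i, j) \<in> ?L"
      proof
        assume "(i, j) \<in> map_prod ?s ?s ` inversions n \<sigma>"
        then obtain i' j' where "(i', j') \<in> inversions n \<sigma>" "i = ?s i'" "j = ?s j'" by auto
        then show ?thesis unfolding mem using skip[of i'] skip[of j'] ran
          by (simp add: inversions_def skip_position_less_iff)
      next
        assume "(i, j) \<in> {p} \<times> {p<..Suc n}"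
        then have ij: "i = p" "p < j" "j \<le> Suc n" by auto
        then obtain j' where j': "j' \<in> {1..n}" "j = ?s j'" using cases[of j] by auto
        have "?\<pi> j < ?\<pi> i" using skip[OF j'(1)] small[OF j'(1)] at_p ij(1) j'(2) by simp
        then show ?thesis unfolding mem using ij p by simp
      qed
    qed
  qed
qed

lemma card_inversions_insert_largest:
  assumes "p \<in> {1..Suc n}" "\<sigma> permutes {1..n}"
  shows "card (inversions (Suc n) (\<sigma> \<circ> insertion_cycle n p)) =
    card (inversions n \<sigma>) + (Suc n - p)"
proof -
  have "inj_on (map_prod (skip_position p) (skip_position p)) (inversions n \<sigma>)"
    using prod.inj_map[OF inj_skip_position inj_skip_position] by (rule inj_on_subset) simp
  then show ?thesis
    unfolding inversions_insert_largest[OF assms]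
    by (subst card_Un_disjoint) (auto simp: card_image card_cartesian_product)
qed

lemma card_overlinable_insert_largest:
  assumes "p \<in> {1..Suc n}" "\<sigma> permutes {1..n}"
  shows "card (fst ` inversions (Suc n) (\<sigma> \<circ> insertion_cycle n p)) =
    card (fst ` inversions n \<sigma>) + (if p \<le> n then 1 else 0)"
proof -
  have "fst ` inversions (Suc n) (\<sigma> \<circ> insertion_cycle n p) =
      skip_position p ` fst ` inversions n \<sigma> \<union> (if p \<le> n then {p} else {})"
    unfolding inversions_insert_largest[OF assms]
    by (auto simp: image_Un image_image split: prod.splits)
  moreover have "card (skip_position p ` fst ` inversions n \<sigma>) = card (fst ` inversions n \<sigma>)"
    by (rule card_image) (rule inj_on_subset[OF inj_skip_position], simp)
  moreover have "p \<notin> skip_position p ` fst ` inversions n \<sigma>"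
    by (simp add: image_iff)
  ultimately show ?thesis by simp
qed

section \<open>The recurrence and unimodality\<close>

lemma over_Mahonian_0: "over_Mahonian 0 k = (if k = 0 then 1 else 0)"
proof -
  have "inversions 0 \<sigma> = {}" for \<sigma> unfolding inversions_def by auto
  moreover have "{\<sigma>. \<sigma> permutes {1..0::nat}} = {id}" by auto
  ultimately show ?thesis unfolding over_Mahonian_weighted by simp
qed

text \<open>
  The summation index \<open>c\<close> is the number of entries to the right of the largest one; the factor
  \<open>2\<close> counts the choices for overlining it.
\<close>

lemma over_Mahonian_Suc:
  "over_Mahonian (Suc n) k =
     (\<Sum>c=0..n. (if c = 0 then 1 else 2) * (if c \<le> k then over_Mahonian n (k - c) else 0))"
proof -
  let ?w = "\<lambda>n \<sigma> k. if card (inversions n \<sigma>) = k then 2 ^ card (fst ` inversions n \<sigma>) else (0::nat)"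
  let ?P = "\<lambda>n. {\<sigma>. \<sigma> permutes {1..n::nat}}"
  have "over_Mahonian (Suc n) k = (\<Sum>\<pi>\<in>?P (Suc n). ?w (Suc n) \<pi> k)"
    by (rule over_Mahonian_weighted)
  also have "\<dots> = (\<Sum>(p, \<sigma>)\<in>{1..Suc n} \<times> ?P n. ?w (Suc n) (\<sigma> \<circ> insertion_cycle n p) k)"
    by (subst sum.reindex_bij_betw[OF bij_betw_insert_largest, symmetric])
       (intro sum.cong refl, auto)
  also have "\<dots> = (\<Sum>p=1..Suc n. \<Sum>\<sigma>\<in>?P n. ?w (Suc n) (\<sigma> \<circ> insertion_cycle n p) k)"
    by (simp add: sum.cartesian_product)
  also have "\<dots> = (\<Sum>p=1..Suc n. \<Sum>\<sigma>\<in>?P n. (if p \<le> n then 2 else 1) *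
      (if Suc n - p \<le> k then ?w n \<sigma> (k - (Suc n - p)) else 0))"
    by (intro sum.cong refl)
       (auto simp: card_inversions_insert_largest card_overlinable_insert_largest)
  also have "\<dots> = (\<Sum>p=1..Suc n. (if p \<le> n then 2 else 1) *
      (if Suc n - p \<le> k then over_Mahonian n (k - (Suc n - p)) else 0))"
    by (intro sum.cong refl) (simp add: over_Mahonian_weighted sum_distrib_left)
  also have "\<dots> = (\<Sum>c=0..n. (if c = 0 then 1 else 2) *
      (if c \<le> k then over_Mahonian n (k - c) else 0))"
    by (rule sum.reindex_bij_witness[of _ "\<lambda>c. Suc n - c" "\<lambda>p. Suc n - p"]) auto
  finally show ?thesis .
qed

definition over_Mahonian_int :: "nat \<Rightarrow> int \<Rightarrow> real" where
  "over_Mahonian_int n k = (if k < 0 then 0 else real (over_Mahonian n (nat k)))"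

lemma over_Mahonian_int_Suc:
  "over_Mahonian_int (Suc n) k =
     over_Mahonian_int n k + 2 * (\<Sum>c=1..n. over_Mahonian_int n (k - int c))"
proof (cases "k < 0")
  case False
  then obtain l where l: "k = int l" by (metis int_nat_eq not_less)
  have shift: "over_Mahonian_int n (int l - int c) =
      real (if c \<le> l then over_Mahonian n (l - c) else 0)" for c
    by (simp add: over_Mahonian_int_def nat_diff_distrib)
  have "over_Mahonian_int (Suc n) k = (\<Sum>c=0..n. (if c = 0 then 1 else 2) *
      over_Mahonian_int n (int l - int c))"
    unfolding shift by (simp add: over_Mahonian_int_def over_Mahonian_Suc l) (auto intro!: sum.cong)
  also have "\<dots> = over_Mahonian_int n k + 2 * (\<Sum>c=1..n. over_Mahonian_int n (k - int c))"
    by (simp add: sum.atLeast_Suc_atMost l sum_distrib_left)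
  finally show ?thesis .
qed (simp add: over_Mahonian_int_def)

lemma over_Mahonian_int_has_peak: "\<exists>p. has_peak (over_Mahonian_int n) p"
proof (induction n)
  case 0
  have "has_peak (over_Mahonian_int 0) 0"
    by (rule has_peakI_step) (simp_all add: over_Mahonian_int_def over_Mahonian_0)
  then show ?case by blast
next
  case (Suc n)
  then obtain p where "has_peak (over_Mahonian_int n) p" by blast
  moreover have "over_Mahonian_int (Suc n) =
      (\<lambda>k. over_Mahonian_int n k + 2 * (\<Sum>c=1..n. over_Mahonian_int n (k - int c)))"
    by (rule ext) (rule over_Mahonian_int_Suc)
  ultimately show ?case using has_peak_window_sum[of "over_Mahonian_int n" p n] by simp
qed

theorem corollary4p4:
  fixes n :: nat
  assumes "n \<ge> 1"
  shows "unimodal_upto (\<lambda>k. real (over_Mahonian n k)) (n choose 2)"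
proof -
  obtain p where "has_peak (over_Mahonian_int n) p"
    using over_Mahonian_int_has_peak by blast
  then have "unimodal_upto (\<lambda>k. over_Mahonian_int n (int k)) (n choose 2)"
    by (rule unimodal_upto_if_has_peak)
  then show ?thesis by (simp add: over_Mahonian_int_def)
qed

end
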